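(* Let $\mu$ be an s-finite measure on a measurable space $X$. Then $\mu$ has a top $0$-$\infty$-set, denoted $\infty[\mu]$, which is unique up to $\mu$-null sets. Moreover, $\mu$ is $\sigma$-finite if and only if $\infty[\mu]$ is trivial, i.e. $\mu(\infty[\mu])=0$.
   Context: A measure is s-finite if it is a countable sum of finite measures. A measure $\mu$ on $X$ is $\sigma$-finite if $X$ is a countable union of measurable sets of finite $\mu$-measure. A set $U\in\Sigma_X$ is a $0$-$\infty$-set for $\mu$ if every measurable $V\subseteq U$ satisfies $\mu(V)\in\{0,\infty\}$; it is trivial if $\mu(U)=0$. A $0$-$\infty$-set $A$ for $\mu$ is a top $0$-$\infty$-set if $\mu(B\setminus A)=0$ for every $0$-$\infty$-set $B$ for $\mu$. *)

theory Defs
  imports "HOL-Analysis.Analysis"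
begin

text \<open>The summands are indexed by \<open>nat\<close>; finite (or empty) sums are covered by zero summands.\<close>

definition s_finite_measure :: "'a measure \<Rightarrow> bool" where
  "s_finite_measure M \<longleftrightarrow>
     (\<exists>N :: nat \<Rightarrow> 'a measure.
        (\<forall>i. finite_measure (N i) \<and> sets (N i) = sets M) \<and>
        (\<forall>A\<in>sets M. emeasure M A = (\<Sum>i. emeasure (N i) A)))"

definition zero_infty_set :: "'a measure \<Rightarrow> 'a set \<Rightarrow> bool" where
  "zero_infty_set M U \<longleftrightarrow>
     U \<in> sets M \<and> (\<forall>V\<in>sets M. V \<subseteq> U \<longrightarrow> emeasure M V \<in> {0, \<infinity>})"

definition top_zero_infty_set :: "'a measure \<Rightarrow> 'a set \<Rightarrow> bool" where
  "top_zero_infty_set M A \<longleftrightarrow>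
     zero_infty_set M A \<and> (\<forall>B. zero_infty_set M B \<longrightarrow> emeasure M (B - A) = 0)"

end

theory Submission
  imports Defs
begin

text \<open>A weighted sum of the finite summands of \<open>M\<close> is a finite measure that dominates \<open>M\<close>.
  The exhaustion step of the Radon--Nikodym theorem then splits the space into countably many sets
  of finite \<open>M\<close>-measure and a rest on which \<open>M\<close> only takes the values \<open>0\<close> and \<open>\<infinity>\<close>; the rest is
  a top set because every zero-infinity set meets a set of finite measure in a null set.\<close>

text \<open>These weights will turn a countable sum of finite measures into a finite measure. They
  must be strictly positive, so that no summand is lost.\<close>

lemma ex_finite_weights:
  fixes a :: "nat \<Rightarrow> ennreal"
  assumes "\<And>i. a i \<noteq> \<infinity>"
  shows "\<exists>c. (\<forall>i. 0 < c i) \<and> (\<Sum>i. c i * a i) \<noteq> \<infinity>"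
proof -
  define r where "r i = enn2real (a i)" for i
  have r: "a i = ennreal (r i)" "0 \<le> r i" for i
    using assms[of i] by (auto simp: r_def less_top)
  \<comment> \<open>Since \<open>r i / (1 + r i)\<close> is at most 1, each weighted term is bounded
    by a term of a convergent geometric series. The summand 1 keeps the denominator positive when
    \<open>r i = 0\<close>.\<close>
  define c where "c i = ennreal ((1/2) ^ Suc i / (1 + r i))" for i
  have "c i * a i \<le> ennreal ((1/2) ^ Suc i)" for i
  proof -
    have "c i * a i = ennreal ((1/2) ^ Suc i / (1 + r i) * r i)"
      unfolding c_def r(1)[of i] using r(2)[of i] by (intro ennreal_mult[symmetric]) auto
    also have "(1/2) ^ Suc i / (1 + r i) * r i = (1/2) ^ Suc i * (r i / (1 + r i))"
      by simp
    also have "\<dots> \<le> (1/2) ^ Suc i"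
      using r(2)[of i] by (intro mult_right_le_one_le) (auto simp: divide_le_eq_1)
    finally show ?thesis
      by (simp add: ennreal_leI)
  qed
  then have "(\<Sum>i. c i * a i) \<le> (\<Sum>i. ennreal ((1/2) ^ Suc i))"
    by (intro suminf_le) auto
  also have "\<dots> < \<infinity>"
    by (simp add: less_top[symmetric] ennreal_suminf_neq_top summable_geometric summable_Suc_iff
        del: power_Suc)
  finally have "(\<Sum>i. c i * a i) \<noteq> \<infinity>"
    by simp
  moreover have "0 < c i" for i
    using r(2)[of i] by (simp add: c_def)
  ultimately show ?thesis
    by blast
qed

text \<open>Tonelli for counting measure: the inner sum over \<open>i\<close> is an integral over
  \<open>count_space UNIV\<close>, which commutes with countable sums of nonnegative
  functions.\<close>

lemma ennreal_suminf_swap: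
  fixes f :: "nat \<Rightarrow> nat \<Rightarrow> ennreal"
  shows "(\<Sum>j. \<Sum>i. f i j) = (\<Sum>i. \<Sum>j. f i j)"
  using nn_integral_suminf[of "\<lambda>j i. f i j" "count_space UNIV"]
  by (simp add: nn_integral_count_space_nat)

text \<open>\<open>P\<close> is the weighted sum of the finite summands. As every weight is
  positive, a \<open>P\<close>-null set is null for each summand and hence for
  \<open>M\<close>.\<close>

lemma s_finite_measure_dominated:
  assumes "s_finite_measure M"
  obtains P where "finite_measure P" "sets P = sets M" "absolutely_continuous P M"
proof -
  obtain N :: "nat \<Rightarrow> 'a measure" where N: "\<And>i. finite_measure (N i)" "\<And>i. sets (N i) = sets M"
    and M_eq: "\<And>A. A \<in> sets M \<Longrightarrow> emeasure M A = (\<Sum>i. emeasure (N i) A)"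
    using assms unfolding s_finite_measure_def by metis
  obtain c where c_pos: "\<And>i. 0 < c i"
    and c_fin: "(\<Sum>i. c i * emeasure (N i) (space M)) \<noteq> \<infinity>"
    using ex_finite_weights[of "\<lambda>i. emeasure (N i) (space M)"]
      finite_measure.emeasure_finite[OF N(1)] by (metis infinity_ennreal_def)
  define P where "P = measure_of (space M) (sets M) (\<lambda>A. \<Sum>i. c i * emeasure (N i) A)"
  have sets_P: "sets P = sets M" and space_P: "space P = space M"
    by (simp_all add: P_def)
  have P_eq: "emeasure P A = (\<Sum>i. c i * emeasure (N i) A)" if "A \<in> sets M" for A
  unfolding P_def
  proof (rule emeasure_measure_of_sigma[OF sets.sigma_algebra_axioms])
    show "countably_additive (sets M) (\<lambda>A. \<Sum>i. c i * emeasure (N i) A)"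
    proof (rule countably_additiveI)
      fix B :: "nat \<Rightarrow> 'a set"
      assume B: "range B \<subseteq> sets M" "disjoint_family B"
      have "(\<Sum>j. \<Sum>i. c i * emeasure (N i) (B j)) = (\<Sum>i. \<Sum>j. c i * emeasure (N i) (B j))"
        by (rule ennreal_suminf_swap)
      also have "\<dots> = (\<Sum>i. c i * emeasure (N i) (\<Union>j. B j))"
        using B by (simp add: suminf_emeasure N(2))
      finally show "(\<Sum>j. \<Sum>i. c i * emeasure (N i) (B j)) = (\<Sum>i. c i * emeasure (N i) (\<Union>j. B j))" .
    qed
  qed (use that in \<open>auto simp: positive_def\<close>)
  have "finite_measure P"
    using c_fin by (intro finite_measureI) (simp add: space_P P_eq)
  moreover have "absolutely_continuous P M"
    unfolding absolutely_continuous_def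
  proof
    fix A assume "A \<in> null_sets P"
    then have A: "A \<in> sets M" "(\<Sum>i. c i * emeasure (N i) A) = 0"
      using P_eq sets_P by (auto simp: null_sets_def)
    have "emeasure (N i) A = 0" for i
    proof -
      have "c i * emeasure (N i) A = 0"
        using A(2) by (simp add: suminf_eq_zero_iff)
      then show ?thesis
        using c_pos[of i] by auto
    qed
    with A(1) show "A \<in> null_sets M"
      by (simp add: null_sets_def M_eq)
  qed
  ultimately show thesis
    using that sets_P by blast
qed

text \<open>Each piece \<open>C \<inter> B i\<close> lies in \<open>U\<close> and has finite
  measure, so its measure must be 0; countably many such pieces make up \<open>C\<close>.\<close>

lemma zero_infty_set_null_if_sigma_finite_cover:
  fixes B :: "nat \<Rightarrow> 'a set"
  assumes U: "zero_infty_set M U" and C: "C \<in> sets M" "C \<subseteq> U" "C \<subseteq> (\<Union>i. B i)"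
    and B: "range B \<subseteq> sets M" "\<And>i. emeasure M (B i) \<noteq> \<infinity>"
  shows "emeasure M C = 0"
proof -
  have meas: "C \<inter> B i \<in> sets M" for i
    using B(1) C(1) by auto
  have "emeasure M (C \<inter> B i) = 0" for i
  proof -
    have "emeasure M (C \<inter> B i) \<le> emeasure M (B i)"
      using B(1) by (intro emeasure_mono) auto
    then have "emeasure M (C \<inter> B i) \<noteq> \<infinity>"
      using B(2)[of i] by (auto simp: top_unique)
    then show ?thesis
      using U C(2) meas[of i] unfolding zero_infty_set_def by blast
  qed
  then have "emeasure M (\<Union>i. C \<inter> B i) = 0"
    using meas by (intro emeasure_UN_eq_0) auto
  moreover have "(\<Union>i. C \<inter> B i) = C"
    using C(3) by blast
  ultimately show ?thesis
    by simp
qed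

lemma s_finite_measure_split:
  assumes "s_finite_measure M"
  obtains B :: "nat \<Rightarrow> 'a set" where "range B \<subseteq> sets M" "\<And>i. emeasure M (B i) \<noteq> \<infinity>"
    "zero_infty_set M (space M - (\<Union>i. B i))"
proof -
  obtain P where P: "finite_measure P" "sets P = sets M" "absolutely_continuous P M"
    using s_finite_measure_dominated[OF assms] .
  \<comment> \<open>The exhaustion needs a finite measure whose null sets are \<open>M\<close>-null,
    which is what \<open>P\<close> provides. Afterwards only the values of \<open>M\<close> in the
    dichotomy matter.\<close>
  obtain B :: "nat \<Rightarrow> 'a set" where B: "range B \<subseteq> sets M" "\<And>i. emeasure M (B i) \<noteq> \<infinity>"
    and "\<forall>A\<in>sets M. A \<inter> (\<Union>i. B i) = {} \<longrightarrow>
      (emeasure P A = 0 \<and> emeasure M A = 0) \<or> (emeasure P A > 0 \<and> emeasure M A = \<infinity>)"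
    using finite_measure.split_space_into_finite_sets_and_rest[OF P(1,3) P(2)[symmetric]]
    unfolding P(2) by blast
  then have rest: "emeasure M A \<in> {0, \<infinity>}" if "A \<in> sets M" "A \<inter> (\<Union>i. B i) = {}" for A
    using that by blast
  have "zero_infty_set M (space M - (\<Union>i. B i))"
    unfolding zero_infty_set_def
  proof (intro conjI ballI impI)
    show "space M - (\<Union>i. B i) \<in> sets M"
      using B(1) by blast
  qed (use rest in blast)
  with B show thesis
    using that by blast
qed

theorem theorem8:
  fixes M :: "'a measure"
  assumes "s_finite_measure M"
  shows "(\<exists>A. top_zero_infty_set M A) \<and>
         (\<forall>A B. top_zero_infty_set M A \<longrightarrow> top_zero_infty_set M B \<longrightarrow>
            (A - B) \<union> (B - A) \<in> null_sets M) \<and>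
         (\<forall>A. top_zero_infty_set M A \<longrightarrow>
            (sigma_finite_measure M \<longleftrightarrow> emeasure M A = 0))"
proof -
  obtain B :: "nat \<Rightarrow> 'a set" where B: "range B \<subseteq> sets M" "\<And>i. emeasure M (B i) \<noteq> \<infinity>"
    and R: "zero_infty_set M (space M - (\<Union>i. B i))"
    using s_finite_measure_split[OF assms] by blast
  define R where "R = space M - (\<Union>i. B i)"
  have R_sets: "R \<in> sets M"
    using R by (simp add: zero_infty_set_def R_def)
  \<comment> \<open>Outside \<open>R\<close> the space is covered by the sets \<open>B i\<close> of
    finite measure, so the part of \<open>U\<close> there is null.\<close>
  have "emeasure M (U - R) = 0" if U: "zero_infty_set M U" for U
  proof (rule zero_infty_set_null_if_sigma_finite_cover[OF U _ _ _ B])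
    have "U \<in> sets M"
      using U by (simp add: zero_infty_set_def)
    then show "U - R \<in> sets M" "U - R \<subseteq> (\<Union>i. B i)"
      using R_sets sets.sets_into_space[of U M] by (auto simp: R_def)
  qed auto
  then have "top_zero_infty_set M R"
    using R by (simp add: top_zero_infty_set_def R_def)
  \<comment> \<open>Each of the two sets is a zero-infinity set, so the top property of the other
    applies to it.\<close>
  moreover have "(A - A') \<union> (A' - A) \<in> null_sets M"
    if "top_zero_infty_set M A" "top_zero_infty_set M A'" for A A'
  proof (rule null_sets.Un)
    show "A - A' \<in> null_sets M" "A' - A \<in> null_sets M"
      using that by (simp_all add: top_zero_infty_set_def zero_infty_set_def null_sets_def sets.Diff)
  qed
  moreover have "sigma_finite_measure M \<longleftrightarrow> emeasure M A = 0" if A: "top_zero_infty_set M A" for A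
  proof
    have A_sets: "A \<in> sets M" and A_zi: "zero_infty_set M A"
      using A by (auto simp: top_zero_infty_set_def zero_infty_set_def)
    show "emeasure M A = 0" if sf: "sigma_finite_measure M"
    proof -
      obtain D :: "nat \<Rightarrow> 'a set" where D: "range D \<subseteq> sets M" "(\<Union>i. D i) = space M"
          "\<And>i. emeasure M (D i) \<noteq> \<infinity>"
        using sigma_finite_measure.sigma_finite[OF sf] by blast
      show ?thesis
        using zero_infty_set_null_if_sigma_finite_cover[OF A_zi A_sets _ _ D(1,3)] D(2)
          sets.sets_into_space[OF A_sets] by simp
    qed
    assume "emeasure M A = 0"
    with A_sets have "A \<in> null_sets M"
      by auto
    \<comment> \<open>\<open>A\<close> is an arbitrary top set, so nullness must be carried over to
      \<open>R\<close>: the top property of \<open>A\<close> applies to the zero-infinity set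
      \<open>R\<close>.\<close>
    moreover have "R - A \<in> null_sets M"
      using A R R_sets A_sets by (auto simp: top_zero_infty_set_def R_def)
    ultimately have "A \<union> (R - A) \<in> null_sets M"
      by (rule null_sets.Un)
    then have "R \<in> null_sets M"
      by (rule null_sets_subset[OF _ R_sets]) auto
    then have "emeasure M R = 0"
      by auto
    show "sigma_finite_measure M"
    proof (unfold_locales, intro exI conjI ballI)
      \<comment> \<open>Once \<open>R\<close> is null, adding it to the sets \<open>B i\<close>
        gives a countable cover of the space by sets of finite measure.\<close>
      show "countable (insert R (range B))"
        by simp
      show "insert R (range B) \<subseteq> sets M"
        using R_sets B(1) by simp
      show "\<Union> (insert R (range B)) = space M"
      proof
        show "\<Union> (insert R (range B)) \<subseteq> space M"
          using B(1) R_sets by (auto dest: sets.sets_into_space)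
      qed (auto simp: R_def)
    qed (use B(2) \<open>emeasure M R = 0\<close> in auto)
  qed
  ultimately show ?thesis
    by (intro conjI allI impI exI[of _ R])
qed

end
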